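(* Let $\Gamma$ be a finite 2-edge-connected graph, let $T\subseteq E(\Gamma)$ be a spanning tree, and set $r:=|T|$. Then $$\det \mathcal C_q(\Gamma,T)=\sum_{i=0}^{r} c_i\,q^{2i},$$ where $c_i$ is the number of spanning trees $T'$ of $\Gamma$ with $|T'\cap T|=r-i$. (In particular, $c_0=1$.)
   Context: Graphs are finite, with loop edges and multiple edges allowed; 2-edge-connected means connected and remaining connected after removal of any one edge. Spanning trees are identified with their edge sets. Fix an arbitrary orientation of the edges of $\Gamma$, and let $\mathbb Z^E$, $E=E(\Gamma)$, have the Euclidean inner product $\langle\cdot,\cdot\rangle$ with $E$ orthonormal. For $i\in T$, removing $i$ splits $T$ into two components, giving a vertex partition $V_{0,i}\sqcup V_{1,i}$ with $i$ directed from $V_{0,i}$ to $V_{1,i}$; the fundamental cut $K_i\in\mathbb Z^E$ is the sum of all edges of $\Gamma$ directed from $V_{0,i}$ to $V_{1,i}$ minus the sum of all edges directed from $V_{1,i}$ to $V_{0,i}$. The $q$-cut lattice $\mathcal C_q(\Gamma,T)$ is the free $\mathbb Z[q,q^{-1}]$-module with basis $\{\ell_i\}_{i\in T}$ and with the sesquilinear form ($q$-antilinear, i.e. twisted by $q\mapsto q^{-1}$, in the first argument and linear in the second) determined by $$\langle \ell_i,\ell_i\rangle=1+(\langle K_i,K_i\rangle-1)q^2,\qquad \langle \ell_i,\ell_j\rangle=\langle K_i,K_j\rangle q^2\ \ (i\ne j).$$ The determinant of a $q$-lattice is the determinant of its Gram matrix $(\langle b_i,b_j\rangle)$ in any basis;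 it does not depend on the basis. *)

theory Defs
  imports
    "Graph_Theory.Digraph_Component"
    "Jordan_Normal_Form.Determinant"
    "HOL-Library.Poly_Mapping"
begin

text \<open>
  A finite multigraph \<open>\<Gamma>\<close> (loops and parallel edges allowed) together with an arbitrary
  orientation of its edges is a \<open>fin_digraph\<close>.  All graph-theoretic notions below refer to the
  underlying undirected graph.  \<open>connected\<close> of \<open>Digraph_Component\<close> is already undirected, but
  its \<open>forest\<close>, \<open>tree\<close> and \<open>spanning_tree\<close> forbid only directed cycles and are therefore
  unsuitable; undirected acyclicity is defined here.
\<close>

text \<open>Every edge may be traversed in both directions: \<open>(e, True)\<close> along the orientation,
  \<open>(e, False)\<close> against it.\<close>

definition bidirect :: "('v, 'e) pre_digraph \<Rightarrow> ('v, 'e \<times> bool) pre_digraph" where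
  "bidirect G = \<lparr> verts = verts G, arcs = arcs G \<times> UNIV,
     tail = (\<lambda>(e, b). if b then tail G e else head G e),
     head = (\<lambda>(e, b). if b then head G e else tail G e) \<rparr>"

text \<open>Distinctness of the underlying edges excludes running back and forth along one edge, but
  keeps loops (length 1) and pairs of parallel edges (length 2) as cycles.\<close>

definition undirected_cycle :: "('v, 'e) pre_digraph \<Rightarrow> ('e \<times> bool) list \<Rightarrow> bool" where
  "undirected_cycle G p \<longleftrightarrow> pre_digraph.cycle (bidirect G) p \<and> distinct (map fst p)"

definition undirected_tree :: "('v, 'e) pre_digraph \<Rightarrow> bool" where
  "undirected_tree G \<longleftrightarrow> Digraph_Component.connected G \<and> \<not> (\<exists>p. undirected_cycle G p)"

definition spanning_subgraph :: "('v, 'e) pre_digraph \<Rightarrow> 'e set \<Rightarrow> ('v, 'e) pre_digraph" where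
  "spanning_subgraph G S = G\<lparr> arcs := S \<rparr>"

definition spanning_tree_edges :: "('v, 'e) pre_digraph \<Rightarrow> 'e set \<Rightarrow> bool" where
  "spanning_tree_edges G S \<longleftrightarrow> S \<subseteq> arcs G \<and> undirected_tree (spanning_subgraph G S)"

definition two_edge_connected :: "('v, 'e) pre_digraph \<Rightarrow> bool" where
  "two_edge_connected G \<longleftrightarrow> Digraph_Component.connected G \<and>
     (\<forall>e \<in> arcs G. Digraph_Component.connected (pre_digraph.del_arc G e))"

definition component_of :: "('v, 'e) pre_digraph \<Rightarrow> 'v \<Rightarrow> 'v set" where
  "component_of G u = {v. reachable (with_proj (mk_symmetric G)) u v}"

text \<open>Vectors of \<open>\<int>\<^sup>E\<close> are functions on edges, of which only the values on \<open>arcs G\<close> matter.\<close>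

definition edge_inner :: "('v, 'e) pre_digraph \<Rightarrow> ('e \<Rightarrow> int) \<Rightarrow> ('e \<Rightarrow> int) \<Rightarrow> int" where
  "edge_inner G x y = (\<Sum>e \<in> arcs G. x e * y e)"

definition fundamental_cut :: "('v, 'e) pre_digraph \<Rightarrow> 'e set \<Rightarrow> 'e \<Rightarrow> 'e \<Rightarrow> int" where
  "fundamental_cut G T i =
     (let H = pre_digraph.del_arc (spanning_subgraph G T) i;
          V0 = component_of H (tail G i);
          V1 = component_of H (head G i)
      in (\<lambda>e. if e \<in> arcs G \<and> tail G e \<in> V0 \<and> head G e \<in> V1 then 1
              else if e \<in> arcs G \<and> tail G e \<in> V1 \<and> head G e \<in> V0 then - 1
              else 0))"


text \<open>The ring \<open>\<int>[q, q\<^sup>-\<^sup>1]\<close>, as the group ring of \<open>\<int>\<close>: finitely supported functions from exponents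
  to coefficients, with convolution as multiplication.\<close>

type_synonym laurent = "int \<Rightarrow>\<^sub>0 int"

definition qvar :: laurent where
  "qvar = Poly_Mapping.single 1 1"

definition qbar :: "laurent \<Rightarrow> laurent" where
  "qbar = Poly_Mapping.map_key uminus"

definition qscale :: "laurent \<Rightarrow> ('e \<Rightarrow>\<^sub>0 laurent) \<Rightarrow> ('e \<Rightarrow>\<^sub>0 laurent)" where
  "qscale c v = Poly_Mapping.map ((*) c) v"

lemma lookup_qscale [simp]: "Poly_Mapping.lookup (qscale c v) i = c * Poly_Mapping.lookup v i"
  by (simp add: qscale_def Poly_Mapping.map.rep_eq when_def)

global_interpretation qmodule: Modules.module qscale
  by unfold_locales (auto intro!: poly_mapping_eqI simp: lookup_add algebra_simps)

text \<open>A \<open>q\<close>-lattice: a free submodule of finite rank, with a sesquilinear form on it.\<close>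

record 'e q_lattice =
  lat_carrier :: "('e \<Rightarrow>\<^sub>0 laurent) set"
  lat_form :: "('e \<Rightarrow>\<^sub>0 laurent) \<Rightarrow> ('e \<Rightarrow>\<^sub>0 laurent) \<Rightarrow> laurent"

definition lat_basis :: "'e q_lattice \<Rightarrow> ('e \<Rightarrow>\<^sub>0 laurent) list \<Rightarrow> bool" where
  "lat_basis L bs \<longleftrightarrow> distinct bs \<and> qmodule.independent (set bs) \<and>
     qmodule.span (set bs) = lat_carrier L"

definition gram_matrix :: "'e q_lattice \<Rightarrow> ('e \<Rightarrow>\<^sub>0 laurent) list \<Rightarrow> laurent mat" where
  "gram_matrix L bs =
     mat (length bs) (length bs) (\<lambda>(i, j). lat_form L (bs ! i) (bs ! j))"

text \<open>The common value of the Gram determinants of all bases; nothing can be derived about it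
  without the independence of the chosen basis.\<close>

definition lat_det :: "'e q_lattice \<Rightarrow> laurent" where
  "lat_det L = (THE d. \<exists>bs. lat_basis L bs \<and> d = det (gram_matrix L bs))"

text \<open>The basis vectors \<open>\<ell>\<^sub>i\<close>, \<open>i \<in> T\<close>, of the \<open>q\<close>-cut lattice.\<close>

definition ell :: "'e \<Rightarrow> ('e \<Rightarrow>\<^sub>0 laurent)" where
  "ell i = Poly_Mapping.single i 1"

definition q_cut_entry :: "('v, 'e) pre_digraph \<Rightarrow> 'e set \<Rightarrow> 'e \<Rightarrow> 'e \<Rightarrow> laurent" where
  "q_cut_entry G T i j =
     (let K = fundamental_cut G T in
      if i = j then 1 + of_int (edge_inner G (K i) (K i) - 1) * qvar ^ 2
      else of_int (edge_inner G (K i) (K j)) * qvar ^ 2)"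

definition q_cut_lattice :: "('v, 'e) pre_digraph \<Rightarrow> 'e set \<Rightarrow> 'e q_lattice" where
  "q_cut_lattice G T = \<lparr>
     lat_carrier = qmodule.span (ell ` T),
     lat_form = (\<lambda>x y. \<Sum>i\<in>T. \<Sum>j\<in>T.
        qbar (Poly_Mapping.lookup x i) * Poly_Mapping.lookup y j * q_cut_entry G T i j) \<rparr>"

lemma qbar_zero: "qbar 0 = 0"
  by (simp add: qbar_def)

lemma lookup_qbar: "Poly_Mapping.lookup (qbar p) n = Poly_Mapping.lookup p (- n)"
  by (simp add: qbar_def map_key.rep_eq inj_on_def)

lemma qbar_one: "qbar 1 = 1"
  by (rule poly_mapping_eqI) (simp add: lookup_qbar lookup_one when_def)

lemma qbar_add: "qbar (p + r) = qbar p + qbar r"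
  by (rule poly_mapping_eqI) (simp add: lookup_qbar lookup_add)

lemma qbar_single: "qbar (Poly_Mapping.single n a) = Poly_Mapping.single (- n) a"
  by (rule poly_mapping_eqI) (auto simp: lookup_qbar lookup_single when_def)

lemma laurent_induct [case_names zero add_single]:
  fixes p :: laurent
  assumes "P 0" and "\<And>p n a. P p \<Longrightarrow> P (p + Poly_Mapping.single n a)"
  shows "P p"
proof (induction p rule: update_induct)
  case (update f n a)
  have "Poly_Mapping.update n a f = f + Poly_Mapping.single n a"
    using update.hyps(1)
    by (intro poly_mapping_eqI) (auto simp: lookup_update lookup_add lookup_single when_def in_keys_iff)
  then show ?case using assms(2)[OF update.IH] by simp
qed (rule assms(1))

lemma qbar_mult: "qbar (p * r) = qbar p * qbar r"
proof (induction p rule: laurent_induct)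
  case (add_single p n a)
  have "qbar (Poly_Mapping.single n a * r) = Poly_Mapping.single (- n) a * qbar r"
    by (induction r rule: laurent_induct)
      (simp_all add: qbar_zero qbar_single mult_single qbar_add distrib_left)
  with add_single show ?case by (simp add: qbar_add qbar_single distrib_right)
qed (simp add: qbar_zero)

lemma q_cut_lattice_form_sesquilinear:
  fixes G :: "('v, 'e) pre_digraph" and T :: "'e set"
  defines "B \<equiv> lat_form (q_cut_lattice G T)"
  shows "B (x + x') y = B x y + B x' y" and "B x (y + y') = B x y + B x y'"
    and "B (qscale a x) y = qbar a * B x y" and "B x (qscale a y) = a * B x y"
  by (simp_all add: B_def q_cut_lattice_def lookup_add qbar_add qbar_mult
      sum.distrib sum_distrib_left algebra_simps)

lemma q_cut_lattice_form_ell: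
  assumes "finite T" "i \<in> T" "j \<in> T"
  shows "lat_form (q_cut_lattice G T) (ell i) (ell j) = q_cut_entry G T i j"
proof -
  have "lat_form (q_cut_lattice G T) (ell i) (ell j) =
    (\<Sum>i'\<in>T. \<Sum>j'\<in>T. if i' = i then (if j' = j then q_cut_entry G T i' j' else 0) else 0)"
    unfolding q_cut_lattice_def ell_def q_lattice.simps
    by (intro sum.cong refl) (auto simp: lookup_single when_def qbar_zero qbar_one)
  also have "\<dots> = (\<Sum>i'\<in>T. if i' = i then q_cut_entry G T i' j else 0)"
    using assms by (intro sum.cong refl) (auto simp: sum.delta)
  finally show ?thesis
    using assms by (simp add: sum.delta)
qed

lemma lookup_ell: "Poly_Mapping.lookup (ell j) i = (if i = j then 1 else 0)"
  by (auto simp: ell_def lookup_single when_def)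

lemma ell_eq_iff: "ell i = ell j \<longleftrightarrow> i = j"
  by (metis lookup_ell one_neq_zero)

lemma independent_ell: "qmodule.independent (ell ` T)"
proof
  assume "qmodule.dependent (ell ` T)"
  then obtain S u v where S: "finite S" "S \<subseteq> ell ` T"
    and z: "(\<Sum>v\<in>S. qscale (u v) v) = 0" and v: "v \<in> S" "u v \<noteq> 0"
    by (auto simp: qmodule.dependent_explicit)
  from v S obtain i where i: "v = ell i" by auto
  have "0 = (\<Sum>w\<in>S. u w * Poly_Mapping.lookup w i)"
    using arg_cong[OF z, of "\<lambda>p. Poly_Mapping.lookup p i"] by (simp add: lookup_sum)
  also have "\<dots> = (\<Sum>w\<in>S. if w = v then u v else 0)"
  proof (intro sum.cong refl)
    fix w assume "w \<in> S"
    with S obtain j where "w = ell j" by auto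
    with i show "u w * Poly_Mapping.lookup w i = (if w = v then u v else 0)"
      by (auto simp: lookup_ell ell_eq_iff)
  qed
  finally show False using v S by (simp add: sum.delta)
qed

lemma lat_basis_ell:
  assumes "distinct is" "set is = T"
  shows "lat_basis (q_cut_lattice G T) (map ell is)"
  using assms
  by (auto simp: lat_basis_def q_cut_lattice_def distinct_map inj_on_def ell_eq_iff independent_ell)

end

theory Submission
  imports Defs
begin

text \<open>
  Let \<open>K\<close> be the integer matrix whose rows are the fundamental cuts \<open>K\<^sub>i\<close>, \<open>i \<in> T\<close>, with columns
  indexed by all edges.  The columns in \<open>T\<close> form an identity matrix
  (\<open>fundamental_cut_tree_edge\<close>), because the only tree edge that crosses the cut of \<open>i\<close> is \<open>i\<close>.
  Consequently replacing \<open>\<langle>K\<^sub>i, K\<^sub>j\<rangle>\<close> by the entries of the \<open>q\<close>-cut lattice means giving weight \<open>q\<^sup>2\<close> to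
  the edges outside \<open>T\<close> and weight \<open>1\<close> to those in \<open>T\<close>: the Gram matrix is \<open>K D K\<^sup>T\<close> for this diagonal
  weight matrix \<open>D\<close> (\<open>q_cut_entry_weighted_sum\<close>).

  By the Cauchy--Binet formula the determinant is the sum, over all sets \<open>S\<close> of \<open>r\<close> edges, of
  \<open>q\<close> to the power \<open>2 * card (S - T)\<close> times the square of the minor of \<open>K\<close> on the columns \<open>S\<close>.
  This square is \<open>1\<close> if \<open>S\<close> is a spanning tree and \<open>0\<close> otherwise
  (\<open>det_fundamental_cuts_squared\<close>), as in Kirchhoff's matrix-tree theorem.  Grouping the trees by the
  number of edges outside \<open>T\<close> gives the claim; \<open>T\<close> itself is the only tree counted by \<open>c 0\<close>.

  The minors are evaluated by duality between potentials and cuts.  A fundamental cut is the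
  coboundary of the indicator function of one side, and every coboundary is the combination of
  fundamental cuts whose coefficients are its own values on \<open>T\<close> (\<open>coboundary_expansion\<close>).  For two
  spanning trees this makes the corresponding square blocks of cuts inverse to each other.  For a
  set \<open>S\<close> that is not a tree, a component or a cycle of \<open>S\<close> provides a kernel vector.

  The determinant of the lattice is defined by all bases at once, so one also needs that
  it does not depend on the basis: a base change multiplies it by \<open>qbar u * u\<close> for a unit \<open>u\<close> of
  \<open>\<int>[q, q\<^sup>-\<^sup>1]\<close>, and units are \<open>\<plusminus>q\<^sup>n\<close> (\<open>laurent_unit_qbar\<close>).
\<close>

section \<open>Matrices indexed by lists\<close>

text \<open>
  Rows and columns are labelled by the entries of two lists: a Gram matrix is labelled by a list of
  basis vectors, while the matrices of fundamental cuts are labelled by edges, which carry no order.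
\<close>

definition list_mat :: "'a list \<Rightarrow> 'b list \<Rightarrow> ('a \<Rightarrow> 'b \<Rightarrow> 'c) \<Rightarrow> 'c mat" where
  "list_mat xs ys a = mat (length xs) (length ys) (\<lambda>(i, j). a (xs ! i) (ys ! j))"

text \<open>
  Edge sets label rows and columns through an arbitrary enumeration.  Its choice changes a minor at
  most by a sign, and minors occur in pairs with the same enumeration, so that the signs cancel.
\<close>

definition enum_list :: "'a set \<Rightarrow> 'a list" where
  "enum_list S = (SOME xs. set xs = S \<and> distinct xs)"

lemma enum_list:
  assumes "finite S"
  shows set_enum_list: "set (enum_list S) = S"
    and distinct_enum_list: "distinct (enum_list S)"
    and length_enum_list: "length (enum_list S) = card S"
proof -
  have "set (enum_list S) = S \<and> distinct (enum_list S)"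
    unfolding enum_list_def using finite_distinct_list[OF assms] by (rule someI_ex)
  then show "set (enum_list S) = S" "distinct (enum_list S)" "length (enum_list S) = card S"
    using distinct_card[of "enum_list S"] by auto
qed

lemma dim_list_mat [simp]:
  "dim_row (list_mat xs ys a) = length xs" "dim_col (list_mat xs ys a) = length ys"
  by (simp_all add: list_mat_def)

lemma list_mat_index [simp]:
  "i < length xs \<Longrightarrow> j < length ys \<Longrightarrow> list_mat xs ys a $$ (i, j) = a (xs ! i) (ys ! j)"
  by (simp add: list_mat_def)

lemma list_mat_cong:
  assumes "\<And>x y. x \<in> set xs \<Longrightarrow> y \<in> set ys \<Longrightarrow> a x y = b x y"
  shows "list_mat xs ys a = list_mat xs ys b"
  by (rule eq_matI) (auto simp: assms)

lemma sum_set_nth: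
  assumes "distinct ys"
  shows "(\<Sum>j\<in>{0..<length ys}. f (ys ! j)) = (\<Sum>y\<in>set ys. f y)"
  using sum.reindex_bij_betw[OF bij_betw_nth[OF assms refl refl], of f]
  by (simp add: atLeast0LessThan)

lemma list_mat_mult:
  fixes a :: "'a \<Rightarrow> 'b \<Rightarrow> 'd::comm_semiring_1"
  assumes "distinct ys"
  shows "list_mat xs ys a * list_mat ys zs b = list_mat xs zs (\<lambda>x z. \<Sum>y\<in>set ys. a x y * b y z)"
  by (rule eq_matI)
    (simp_all add: scalar_prod_def sum_set_nth[OF assms, of "\<lambda>y. a x y * b y z" for x z])

lemma list_mat_transpose: "transpose_mat (list_mat xs ys a) = list_mat ys xs (\<lambda>y x. a x y)"
  by (rule eq_matI) auto

lemma list_mat_one: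
  assumes "distinct xs"
  shows "list_mat xs xs (\<lambda>x y. if x = y then 1 else 0) = 1\<^sub>m (length xs)"
  by (rule eq_matI) (auto simp: nth_eq_iff_index_eq[OF assms])

text \<open>
  Computing the trace of the two products gives \<open>card S\<close> and \<open>card R\<close>.  This one count
  yields both that all bases of a lattice have the same length and that all spanning trees have the
  same number of edges.
\<close>

lemma inverse_matrices_square:
  fixes a :: "'a \<Rightarrow> 'b \<Rightarrow> 'c::{comm_ring_1, ring_char_0}"
  assumes "finite S" "finite R"
    and ab: "\<And>x. x \<in> S \<Longrightarrow> (\<Sum>y\<in>R. a x y * b y x) = 1"
    and ba: "\<And>y. y \<in> R \<Longrightarrow> (\<Sum>x\<in>S. b y x * a x y) = 1"
  shows "card S = card R"
proof -
  have "of_nat (card S) = (\<Sum>x\<in>S. \<Sum>y\<in>R. a x y * b y x)"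
    using ab by simp
  also have "\<dots> = (\<Sum>y\<in>R. \<Sum>x\<in>S. b y x * a x y)"
    by (subst sum.swap) (simp add: mult.commute)
  also have "\<dots> = of_nat (card R)"
    using ba by simp
  finally show ?thesis
    by simp
qed

lemma det_list_mat_inverse:
  fixes a :: "'a \<Rightarrow> 'b \<Rightarrow> 'c::comm_ring_1"
  assumes "distinct xs" "distinct ys" "length xs = length ys"
    and "\<And>x z. x \<in> set xs \<Longrightarrow> z \<in> set xs \<Longrightarrow> (\<Sum>y\<in>set ys. a x y * b y z) = (if x = z then 1 else 0)"
  shows "det (list_mat xs ys a) * det (list_mat ys xs b) = 1"
proof -
  have "list_mat xs ys a * list_mat ys xs b = 1\<^sub>m (length xs)"
    by (simp add: list_mat_mult[OF assms(2)] assms(4) flip: list_mat_one[OF assms(1)] cong: list_mat_cong)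
  moreover have "det (list_mat xs ys a * list_mat ys xs b) = det (list_mat xs ys a) * det (list_mat ys xs b)"
    by (rule det_mult[of _ "length xs"]) (simp_all add: carrier_matI assms(3))
  ultimately show ?thesis
    by simp
qed

lemma det_list_mat_right_kernel:
  fixes a :: "'a \<Rightarrow> 'b \<Rightarrow> 'c::idom"
  assumes "distinct ys" "length xs = length ys"
    and "y \<in> set ys" "z y \<noteq> 0"
    and "\<And>x. x \<in> set xs \<Longrightarrow> (\<Sum>y\<in>set ys. a x y * z y) = 0"
  shows "det (list_mat xs ys a) = 0"
proof -
  let ?v = "vec (length ys) (\<lambda>j. z (ys ! j))"
  have "?v \<noteq> 0\<^sub>v (length ys)"
    using assms(3,4) by (metis in_set_conv_nth index_vec index_zero_vec(1))
  moreover have "list_mat xs ys a *\<^sub>v ?v = 0\<^sub>v (length ys)"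
    using assms(5)
    by (intro eq_vecI)
      (auto simp: scalar_prod_def assms(2) sum_set_nth[OF assms(1), of "\<lambda>y. a x y * z y" for x])
  moreover have "list_mat xs ys a \<in> carrier_mat (length ys) (length ys)"
    by (simp add: carrier_matI assms(2))
  ultimately show ?thesis
    using det_0_iff_vec_prod_zero vec_carrier by blast
qed

lemma det_list_mat_left_kernel:
  fixes a :: "'a \<Rightarrow> 'b \<Rightarrow> 'c::idom"
  assumes "distinct xs" "length xs = length ys"
    and "x \<in> set xs" "z x \<noteq> 0"
    and "\<And>y. y \<in> set ys \<Longrightarrow> (\<Sum>x\<in>set xs. z x * a x y) = 0"
  shows "det (list_mat xs ys a) = 0"
  using det_list_mat_right_kernel[of xs ys x z "\<lambda>y x. a x y"] assms
    det_transpose[of "list_mat xs ys a" "length xs"]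
  by (simp add: list_mat_transpose mult.commute carrier_matI)

lemma det_list_mat_Leibniz:
  assumes "length xs = n" "length ys = n"
  shows "det (list_mat xs ys a) =
    (\<Sum>p | p permutes {0..<n}. signof p * (\<Prod>i\<in>{0..<n}. a (xs ! i) (ys ! p i)))"
proof -
  have "det (list_mat xs ys a) =
    (\<Sum>p | p permutes {0..<n}. signof p * (\<Prod>i\<in>{0..<n}. list_mat xs ys a $$ (i, p i)))"
    by (rule det_def') (simp add: carrier_matI assms)
  also have "\<dots> = (\<Sum>p | p permutes {0..<n}. signof p * (\<Prod>i\<in>{0..<n}. a (xs ! i) (ys ! p i)))"
  proof (intro sum.cong refl arg_cong2[of _ _ _ _ "(*)"] prod.cong)
    fix p i assume "p \<in> {p. p permutes {0..<n}}" "i \<in> {0..<n}"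
    then have "p i < n"
      using permutes_in_image[of p "{0..<n}" i] by auto
    then show "list_mat xs ys a $$ (i, p i) = a (xs ! i) (ys ! p i)"
      using \<open>i \<in> _\<close> assms by simp
  qed
  finally show ?thesis .
qed

lemma det_list_mat_scale_rows:
  fixes a :: "'a \<Rightarrow> 'b \<Rightarrow> 'c::comm_ring_1"
  assumes xs: "distinct xs" and len: "length xs = length ys"
  shows "det (list_mat xs ys (\<lambda>x y. c x * a x y)) = (\<Prod>x\<in>set xs. c x) * det (list_mat xs ys a)"
proof -
  have "(\<Prod>i\<in>{0..<length xs}. c (xs ! i)) = (\<Prod>x\<in>set xs. c x)"
    using prod.reindex_bij_betw[OF bij_betw_nth[OF xs refl refl], of c] by (simp add: atLeast0LessThan)
  then show ?thesis
    by (simp add: det_list_mat_Leibniz[OF refl len[symmetric]] prod.distrib sum_distrib_left mult_ac)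
qed

section \<open>The Cauchy--Binet formula\<close>

text \<open>
  In the Cauchy--Binet expansion an injective choice of one index per row amounts to its image \<open>S\<close>
  and an ordering of \<open>S\<close>.  Relative to a fixed enumeration of \<open>S\<close>, the orderings are the
  permutations.
\<close>

lemma permutations_are_enumerations:
  assumes "distinct ss" "length ss = n"
  shows "bij_betw (\<lambda>p. restrict (\<lambda>i. ss ! p i) {0..<n}) {p. p permutes {0..<n}}
    {f \<in> extensional {0..<n}. inj_on f {0..<n} \<and> f ` {0..<n} = set ss}"
  \<comment> \<open>The inverse map looks up the position in \<open>ss\<close> of each chosen element.\<close>
proof (rule bij_betw_byWitness[where f' = "\<lambda>f i. if i < n then the_inv_into {0..<n} (nth ss) (f i) else i"])
  have bij: "bij_betw (nth ss) {0..<n} (set ss)"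
    using bij_betw_nth[OF assms(1) refl refl] assms(2) by (simp add: atLeast0LessThan)
  then have inj: "inj_on (nth ss) {0..<n}" and im: "nth ss ` {0..<n} = set ss"
    by (auto simp: bij_betw_def)
  show "\<forall>p\<in>{p. p permutes {0..<n}}.
    (\<lambda>i. if i < n then the_inv_into {0..<n} (nth ss) (restrict (\<lambda>i. ss ! p i) {0..<n} i) else i) = p"
  proof (intro ballI ext)
    fix p i assume p: "p \<in> {p. p permutes {0..<n}}"
    then have "i < n \<Longrightarrow> p i \<in> {0..<n}" 
      using permutes_in_image[of p "{0..<n}" i] by auto
    with p show "(if i < n then the_inv_into {0..<n} (nth ss) (restrict (\<lambda>i. ss ! p i) {0..<n} i) else i) = p i"
      by (auto simp: the_inv_into_f_f[OF inj] permutes_not_in)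
  qed
  show "\<forall>f\<in>{f \<in> extensional {0..<n}. inj_on f {0..<n} \<and> f ` {0..<n} = set ss}.
    restrict (\<lambda>i. ss ! (if i < n then the_inv_into {0..<n} (nth ss) (f i) else i)) {0..<n} = f"
  proof (intro ballI ext)
    fix f i assume f: "f \<in> {f \<in> extensional {0..<n}. inj_on f {0..<n} \<and> f ` {0..<n} = set ss}"
    then have "i < n \<Longrightarrow> f i \<in> nth ss ` {0..<n}"
      using im by auto
    with f show "restrict (\<lambda>i. ss ! (if i < n then the_inv_into {0..<n} (nth ss) (f i) else i)) {0..<n} i = f i"
      by (auto simp: f_the_inv_into_f[OF inj] extensional_def)
  qed
  show "(\<lambda>p. restrict (\<lambda>i. ss ! p i) {0..<n}) ` {p. p permutes {0..<n}}
    \<subseteq> {f \<in> extensional {0..<n}. inj_on f {0..<n} \<and> f ` {0..<n} = set ss}"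
  proof (intro image_subsetI CollectI conjI restrict_extensional)
    fix p assume "p \<in> {p. p permutes {0..<n}}"
    then have p: "p permutes {0..<n}" by simp
    have "bij_betw (\<lambda>i. ss ! p i) {0..<n} (set ss)"
      using bij_betw_trans[OF permutes_imp_bij[OF p] bij] by (simp add: comp_def)
    then have "bij_betw (restrict (\<lambda>i. ss ! p i) {0..<n}) {0..<n} (set ss)"
      by (rule bij_betw_cong[THEN iffD1, rotated]) auto
    then show "inj_on (restrict (\<lambda>i. ss ! p i) {0..<n}) {0..<n}"
      and "restrict (\<lambda>i. ss ! p i) {0..<n} ` {0..<n} = set ss"
      by (simp_all only: bij_betw_def)
  qed
  show "(\<lambda>f i. if i < n then the_inv_into {0..<n} (nth ss) (f i) else i) `
    {f \<in> extensional {0..<n}. inj_on f {0..<n} \<and> f ` {0..<n} = set ss} \<subseteq> {p. p permutes {0..<n}}"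
  proof safe
    fix f assume f: "inj_on f {0..<n}" "f ` {0..<n} = set ss"
    have "bij_betw (the_inv_into {0..<n} (nth ss) \<circ> f) {0..<n} {0..<n}"
      using f by (intro bij_betw_trans[OF _ bij_betw_the_inv_into[OF bij]]) (simp add: bij_betw_def)
    then show "(\<lambda>i. if i < n then the_inv_into {0..<n} (nth ss) (f i) else i) permutes {0..<n}"
      by (intro bij_imp_permutes) (auto elim!: bij_betw_cong[THEN iffD1, rotated])
  qed
qed

text \<open>
  Multilinearity in the rows turns the left-hand side into a sum over all choices \<open>f\<close> of one
  summation index per row, each contributing a product of entries of \<open>a\<close> times the determinant of
  the selected rows of \<open>b\<close>.  Choices that repeat an index give equal rows and vanish.  The
  remaining ones are grouped by image \<open>S\<close>; within a group, reordering the rows of \<open>b\<close> produces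
  exactly the signs that assemble the entries of \<open>a\<close> into a second determinant.
\<close>

theorem Cauchy_Binet:
  fixes a :: "'a \<Rightarrow> 'e \<Rightarrow> 'c::comm_ring_1" and b :: "'e \<Rightarrow> 'b \<Rightarrow> 'c"
  assumes E: "finite E" and xs: "length xs = n" and ys: "length ys = n"
  shows "det (list_mat xs ys (\<lambda>x y. \<Sum>e\<in>E. a x e * b e y)) =
    (\<Sum>S | S \<subseteq> E \<and> card S = n. det (list_mat xs (enum_list S) a) * det (list_mat (enum_list S) ys b))"
proof -
  let ?I = "{0..<n}"
  let ?P = "{p. p permutes ?I}"
  let ?F = "PiE ?I (\<lambda>_. E)"
  let ?A = "\<lambda>f. \<Prod>i\<in>?I. a (xs ! i) (f i)"
  let ?D = "\<lambda>f. det (list_mat (map f [0..<n]) ys b)"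
  let ?Inj = "{f \<in> ?F. inj_on f ?I}"
  have finF: "finite ?F"
    using E by (intro finite_PiE) auto
  have "det (list_mat xs ys (\<lambda>x y. \<Sum>e\<in>E. a x e * b e y)) =
    (\<Sum>p\<in>?P. signof p * (\<Prod>i\<in>?I. \<Sum>e\<in>E. a (xs ! i) e * b e (ys ! p i)))"
    using xs ys by (rule det_list_mat_Leibniz)
  also have "\<dots> = (\<Sum>p\<in>?P. \<Sum>f\<in>?F. signof p * (?A f * (\<Prod>i\<in>?I. b (f i) (ys ! p i))))"
    by (subst prod_sum_PiE) (simp_all add: E sum_distrib_left prod.distrib)
  also have "\<dots> = (\<Sum>f\<in>?F. ?A f * ?D f)"
  proof (subst sum.swap, intro sum.cong refl)
    fix f
    have "?D f = (\<Sum>p\<in>?P. signof p * (\<Prod>i\<in>?I. b (map f [0..<n] ! i) (ys ! p i)))"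
      using ys by (intro det_list_mat_Leibniz) simp_all
    also have "\<dots> = (\<Sum>p\<in>?P. signof p * (\<Prod>i\<in>?I. b (f i) (ys ! p i)))"
      by (intro sum.cong prod.cong arg_cong2[of _ _ _ _ "(*)"] refl) simp
    finally show "(\<Sum>p\<in>?P. signof p * (?A f * (\<Prod>i\<in>?I. b (f i) (ys ! p i)))) = ?A f * ?D f"
      by (simp add: sum_distrib_left mult.left_commute cong: prod.cong)
  qed
  also have "\<dots> = (\<Sum>f\<in>?Inj. ?A f * ?D f)"
  proof (rule sum.mono_neutral_right)
    show "\<forall>f\<in>?F - ?Inj. ?A f * ?D f = 0"
    proof
      fix f assume "f \<in> ?F - ?Inj"
      then obtain i j where ij: "i < n" "j < n" "i \<noteq> j" "f i = f j"
        by (auto simp: inj_on_def)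
      have "?D f = 0"
        by (rule det_identical_rows[of _ n i j]) (use ij ys in \<open>auto simp: carrier_matI intro!: eq_vecI\<close>)
      then show "?A f * ?D f = 0"
        by simp
    qed
  qed (use finF in auto)
  also have "\<dots> = (\<Sum>S | S \<subseteq> E \<and> card S = n. \<Sum>f | f \<in> ?Inj \<and> f ` ?I = S. ?A f * ?D f)"
    using finF E
    by (intro sum.group[symmetric]) (auto simp: card_image)
  also have "\<dots> = (\<Sum>S | S \<subseteq> E \<and> card S = n. det (list_mat xs (enum_list S) a) * det (list_mat (enum_list S) ys b))"
  proof (intro sum.cong refl)
    fix S assume "S \<in> {S. S \<subseteq> E \<and> card S = n}"
    then have S: "S \<subseteq> E" "card S = n" "finite S"
      using E finite_subset by auto
    let ?ss = "enum_list S"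
    note ss = enum_list[OF S(3), unfolded S(2)]
    have "{f. f \<in> ?Inj \<and> f ` ?I = S} = {f \<in> extensional ?I. inj_on f ?I \<and> f ` ?I = set ?ss}"
      using S(1) ss(1) by (auto simp: PiE_def)
    then have "(\<Sum>f | f \<in> ?Inj \<and> f ` ?I = S. ?A f * ?D f) =
      (\<Sum>p\<in>?P. ?A (restrict (\<lambda>i. ?ss ! p i) ?I) * ?D (restrict (\<lambda>i. ?ss ! p i) ?I))"
      using sum.reindex_bij_betw[OF permutations_are_enumerations[OF ss(2,3)], of "\<lambda>f. ?A f * ?D f"]
      by simp
    also have "\<dots> = (\<Sum>p\<in>?P. (signof p * (\<Prod>i\<in>?I. a (xs ! i) (?ss ! p i))) * det (list_mat ?ss ys b))"
    proof (intro sum.cong refl)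
      fix p assume "p \<in> ?P"
      then have p: "p permutes ?I" by simp
      have "list_mat (map (restrict (\<lambda>i. ?ss ! p i) ?I) [0..<n]) ys b =
        mat n n (\<lambda>(i, j). list_mat ?ss ys b $$ (p i, j))"
        using permutes_in_image[OF p] ss(3) ys by (intro eq_matI) auto
      then have "?D (restrict (\<lambda>i. ?ss ! p i) ?I) = signof p * det (list_mat ?ss ys b)"
        using det_permute_rows[OF _ p, of "list_mat ?ss ys b"] ss(3) ys
        by (simp add: carrier_matI)
      moreover have "?A (restrict (\<lambda>i. ?ss ! p i) ?I) = (\<Prod>i\<in>?I. a (xs ! i) (?ss ! p i))"
        by (rule prod.cong) auto
      ultimately show "?A (restrict (\<lambda>i. ?ss ! p i) ?I) * ?D (restrict (\<lambda>i. ?ss ! p i) ?I) =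
        (signof p * (\<Prod>i\<in>?I. a (xs ! i) (?ss ! p i))) * det (list_mat ?ss ys b)"
        by (simp only: mult_ac)
    qed
    also have "\<dots> = det (list_mat xs ?ss a) * det (list_mat ?ss ys b)"
      by (simp add: det_list_mat_Leibniz[OF xs ss(3)] sum_distrib_right)
    finally show "(\<Sum>f | f \<in> ?Inj \<and> f ` ?I = S. ?A f * ?D f) =
      det (list_mat xs ?ss a) * det (list_mat ?ss ys b)" .
  qed
  finally show ?thesis .
qed

section \<open>Laurent polynomials and base change\<close>

lemma lookup_laurent_mult:
  fixes u v :: laurent
  shows "Poly_Mapping.lookup (u * v) n = (\<Sum>k\<in>Poly_Mapping.keys u. Poly_Mapping.lookup u k * Poly_Mapping.lookup v (n - k))"
proof -
  have "(\<lambda>k. Sum_any (\<lambda>l. Poly_Mapping.lookup v l when n = k + l)) = (\<lambda>k. Poly_Mapping.lookup v (n - k))"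
  proof
    fix k
    have "(\<lambda>l. Poly_Mapping.lookup v l when n = k + l) = (\<lambda>l. Poly_Mapping.lookup v l when l = n - k)"
      by (auto simp: when_def fun_eq_iff)
    then show "Sum_any (\<lambda>l. Poly_Mapping.lookup v l when n = k + l) = Poly_Mapping.lookup v (n - k)"
      by (simp only: Sum_any_when_equal)
  qed
  then have "Poly_Mapping.lookup (u * v) n = Sum_any (\<lambda>k. Poly_Mapping.lookup u k * Poly_Mapping.lookup v (n - k))"
    by (simp add: lookup_mult fun_eq_iff)
  also have "\<dots> = (\<Sum>k\<in>Poly_Mapping.keys u. Poly_Mapping.lookup u k * Poly_Mapping.lookup v (n - k))"
    by (rule Sum_any.expand_superset) (auto simp: in_keys_iff)
  finally show ?thesis .
qed

text \<open>
  Applied to the largest and to the smallest exponents of both factors: there the convolution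
  has a single term, so nothing can cancel.
\<close>

lemma lookup_extreme_mult:
  fixes u v :: laurent
  assumes "a \<in> Poly_Mapping.keys u" "b \<in> Poly_Mapping.keys v"
    and "\<And>k l. k \<in> Poly_Mapping.keys u \<Longrightarrow> l \<in> Poly_Mapping.keys v \<Longrightarrow> k + l = a + b \<Longrightarrow> k = a"
  shows "Poly_Mapping.lookup (u * v) (a + b) = Poly_Mapping.lookup u a * Poly_Mapping.lookup v b"
proof -
  have "Poly_Mapping.lookup (u * v) (a + b) =
    (\<Sum>k\<in>Poly_Mapping.keys u. if k = a then Poly_Mapping.lookup u a * Poly_Mapping.lookup v b else 0)"
    unfolding lookup_laurent_mult
  proof (intro sum.cong refl)
    fix k assume k: "k \<in> Poly_Mapping.keys u"
    have "a + b - k \<notin> Poly_Mapping.keys v" if "k \<noteq> a"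
      using assms(3)[OF k, of "a + b - k"] that by auto
    then show "Poly_Mapping.lookup u k * Poly_Mapping.lookup v (a + b - k) =
      (if k = a then Poly_Mapping.lookup u a * Poly_Mapping.lookup v b else 0)"
      by (simp add: in_keys_iff)
  qed
  then show ?thesis
    using assms(1) by (simp add: sum.delta)
qed

text \<open>
  A unit is \<open>\<plusminus>q\<^sup>n\<close>: the largest exponents of \<open>u\<close> and \<open>v\<close> add up to \<open>0\<close>, and so do the
  smallest ones, which forces both spreads to be zero.  The bar involution therefore inverts units.
\<close>

lemma laurent_unit_qbar:
  fixes u v :: laurent
  assumes "u * v = 1"
  shows "qbar u * u = 1"
proof -
  have ne: "Poly_Mapping.keys u \<noteq> {}" "Poly_Mapping.keys v \<noteq> {}"
    using assms by (metis keys_eq_empty mult_zero_left mult_zero_right zero_neq_one)+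
  have one: "n = 0" if "Poly_Mapping.lookup (u * v) n \<noteq> 0" for n
    using that unfolding assms by (simp add: lookup_one when_def split: if_splits)
  let ?M = "Max (Poly_Mapping.keys u)" and ?N = "Max (Poly_Mapping.keys v)" and ?m = "Min (Poly_Mapping.keys u)" and ?n = "Min (Poly_Mapping.keys v)"
  have le: "k \<le> ?M" "?m \<le> k" if "k \<in> Poly_Mapping.keys u" for k
    using that by auto
  have le': "l \<le> ?N" "?n \<le> l" if "l \<in> Poly_Mapping.keys v" for l
    using that by auto
  have mem: "?M \<in> Poly_Mapping.keys u" "?N \<in> Poly_Mapping.keys v" "?m \<in> Poly_Mapping.keys u" "?n \<in> Poly_Mapping.keys v"
    using ne by simp_all
  have top: "Poly_Mapping.lookup (u * v) (?M + ?N) = Poly_Mapping.lookup u ?M * Poly_Mapping.lookup v ?N"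
  proof (rule lookup_extreme_mult[OF mem(1,2)])
    fix k l assume "k \<in> Poly_Mapping.keys u" "l \<in> Poly_Mapping.keys v" "k + l = ?M + ?N"
    then show "k = ?M"
      using le(1)[of k] le'(1)[of l] by linarith
  qed
  have bot: "Poly_Mapping.lookup (u * v) (?m + ?n) = Poly_Mapping.lookup u ?m * Poly_Mapping.lookup v ?n"
  proof (rule lookup_extreme_mult[OF mem(3,4)])
    fix k l assume "k \<in> Poly_Mapping.keys u" "l \<in> Poly_Mapping.keys v" "k + l = ?m + ?n"
    then show "k = ?m"
      using le(2)[of k] le'(2)[of l] by linarith
  qed
  have "?M + ?N = 0" "?m + ?n = 0"
    by (rule one, unfold top bot, use mem in \<open>simp add: in_keys_iff\<close>)+
  then have "?m = ?M"
    using le(2)[OF mem(1)] le'(2)[OF mem(2)] by simp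
  then have "k \<notin> Poly_Mapping.keys u" if "k \<noteq> ?M" for k
    using le[of k] that by linarith
  then have u: "u = Poly_Mapping.single ?M (Poly_Mapping.lookup u ?M)"
    by (intro poly_mapping_eqI) (auto simp: lookup_single when_def in_keys_iff)
  have "Poly_Mapping.lookup u ?M * Poly_Mapping.lookup v ?N = 1"
    using top \<open>?M + ?N = 0\<close> by (simp add: assms)
  then have "Poly_Mapping.lookup u ?M * Poly_Mapping.lookup u ?M = 1"
    using zmult_eq_1_iff by auto
  then show ?thesis
    by (subst (1 2) u) (simp add: qbar_single mult_single)
qed

lemma comm_ring_hom_qbar: "comm_ring_hom qbar"
  by unfold_locales (simp_all add: qbar_zero qbar_one qbar_add qbar_mult)

lemma finite_span_expansion:
  assumes "finite B" "v \<in> qmodule.span B"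
  shows "\<exists>c. v = (\<Sum>b\<in>B. qscale (c b) b)"
  using qmodule.span_finite[OF assms(1)] assms(2) by auto

lemma independent_unique:
  assumes "finite B" "qmodule.independent B"
    and "(\<Sum>b\<in>B. qscale (c b) b) = (\<Sum>b\<in>B. qscale (d b) b)" "b \<in> B"
  shows "c b = d b"
proof -
  have "(\<Sum>b\<in>B. qscale (c b - d b) b) = 0"
    using assms(3) by (simp add: qmodule.scale_left_diff_distrib sum_subtractf)
  then have "c b - d b = 0"
    using qmodule.independentD[OF assms(2,1) subset_refl, of "\<lambda>b. c b - d b"] assms(4) by simp
  then show ?thesis
    by simp
qed

text \<open>
  If \<open>U\<close> expresses one basis in terms of the other, the Gram matrix becomes
  \<open>qbar U \<cdot> M \<cdot> U\<^sup>T\<close>, and its determinant is multiplied by \<open>qbar (det U) * det U\<close>.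
  Since both families are bases of the same module, \<open>U\<close> is invertible over \<open>\<int>[q, q\<^sup>-\<^sup>1]\<close>, so this factor
  is \<open>1\<close>.
\<close>

lemma det_gram_basis_change:
  assumes bs: "lat_basis L bs" and cs: "lat_basis L cs"
    and lin: "\<And>x y z. lat_form L (x + y) z = lat_form L x z + lat_form L y z"
      "\<And>x y z. lat_form L x (y + z) = lat_form L x y + lat_form L x z"
      "\<And>a x y. lat_form L (qscale a x) y = qbar a * lat_form L x y"
      "\<And>a x y. lat_form L x (qscale a y) = a * lat_form L x y"
  shows "det (gram_matrix L bs) = det (gram_matrix L cs)"
proof -
  have gram: "gram_matrix L xs = list_mat xs xs (lat_form L)" for xs
    by (simp add: gram_matrix_def list_mat_def)
  have b: "distinct bs" "qmodule.independent (set bs)" "qmodule.span (set bs) = lat_carrier L"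
    and c: "distinct cs" "qmodule.independent (set cs)" "qmodule.span (set cs) = lat_carrier L"
    using bs cs by (simp_all add: lat_basis_def)
  have expansion: "\<exists>u. \<forall>x\<in>set xs. x = (\<Sum>y\<in>set ys. qscale (u x y) y)"
    if "qmodule.span (set xs) = qmodule.span (set ys)" for xs ys :: "('a \<Rightarrow>\<^sub>0 laurent) list"
  proof -
    have "\<forall>x\<in>set xs. \<exists>c. x = (\<Sum>y\<in>set ys. qscale (c y) y)"
      using that qmodule.span_base finite_span_expansion[of "set ys"] by blast
    then show ?thesis
      by (rule bchoice)
  qed
  have "\<exists>u. \<forall>x\<in>set bs. x = (\<Sum>y\<in>set cs. qscale (u x y) y)"
    by (rule expansion) (simp add: b c)
  then obtain u where "\<forall>x\<in>set bs. x = (\<Sum>y\<in>set cs. qscale (u x y) y)" ..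
  note u = bspec[OF this]
  have "\<exists>w. \<forall>x\<in>set cs. x = (\<Sum>y\<in>set bs. qscale (w x y) y)"
    by (rule expansion) (simp add: b c)
  then obtain w where "\<forall>x\<in>set cs. x = (\<Sum>y\<in>set bs. qscale (w x y) y)" ..
  note w = bspec[OF this]
  have inverse: "(\<Sum>y\<in>set ys. u x y * w y z) = (if x = z then 1 else 0)"
    if "qmodule.independent (set xs)" "x \<in> set xs" "z \<in> set xs"
      and u: "\<And>x. x \<in> set xs \<Longrightarrow> x = (\<Sum>y\<in>set ys. qscale (u x y) y)"
      and w: "\<And>y. y \<in> set ys \<Longrightarrow> y = (\<Sum>x\<in>set xs. qscale (w y x) x)"
    for xs ys u w and x z :: "'a \<Rightarrow>\<^sub>0 laurent"
  proof (rule independent_unique[OF _ that(1) _ that(3)])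
    have "(\<Sum>z\<in>set xs. qscale (\<Sum>y\<in>set ys. u x y * w y z) z) =
      (\<Sum>y\<in>set ys. qscale (u x y) (\<Sum>z\<in>set xs. qscale (w y z) z))"
      by (simp add: qmodule.scale_sum_left qmodule.scale_sum_right) (rule sum.swap)
    also have "\<dots> = (\<Sum>y\<in>set ys. qscale (u x y) y)"
      by (intro sum.cong refl arg_cong2[of _ _ _ _ qscale] w[symmetric])
    also have "\<dots> = x"
      by (rule u[OF that(2), symmetric])
    also have "\<dots> = (\<Sum>z\<in>set xs. if z = x then x else 0)"
      using that(2) by (simp add: sum.delta)
    also have "\<dots> = (\<Sum>z\<in>set xs. qscale (if x = z then 1 else 0) z)"
      by (intro sum.cong) auto
    finally show "(\<Sum>z\<in>set xs. qscale (\<Sum>y\<in>set ys. u x y * w y z) z) =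
      (\<Sum>z\<in>set xs. qscale (if x = z then 1 else 0) z)" .
  qed simp
  have uw: "(\<Sum>y\<in>set cs. u x y * w y z) = (if x = z then 1 else 0)"
    if "x \<in> set bs" "z \<in> set bs" for x z
    using inverse[OF b(2) that u w] .
  have wu: "(\<Sum>x\<in>set bs. w y x * u x z) = (if y = z then 1 else 0)"
    if "y \<in> set cs" "z \<in> set cs" for y z
    using inverse[OF c(2) that w u] .
  have "card (set bs) = card (set cs)"
    by (rule inverse_matrices_square[where a = u and b = w]) (simp_all add: uw wu)
  then have len: "length bs = length cs"
    using b c by (simp add: distinct_card)
  let ?n = "length cs"
  let ?U = "list_mat bs cs u" and ?U' = "list_mat bs cs (\<lambda>x y. qbar (u x y))"
  have form0: "lat_form L 0 y = 0" "lat_form L x 0 = 0" for x y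
    using lin(3)[of 0 0 y] lin(4)[of x 0 0] by (simp_all add: qbar_zero)
  have form_sum: "lat_form L (\<Sum>y\<in>A. qscale (f y) y) z = (\<Sum>y\<in>A. qbar (f y) * lat_form L y z)"
    "lat_form L z (\<Sum>y\<in>A. qscale (f y) y) = (\<Sum>y\<in>A. lat_form L z y * f y)" for A f z
    by (induction A rule: infinite_finite_induct) (simp_all add: form0 lin mult.commute)
  have "list_mat bs bs (lat_form L) =
    list_mat bs bs (\<lambda>x z. \<Sum>y'\<in>set cs. (\<Sum>y\<in>set cs. qbar (u x y) * lat_form L y y') * u z y')"
  proof (rule list_mat_cong)
    fix x z assume "x \<in> set bs" "z \<in> set bs"
    then have "lat_form L x z =
      lat_form L (\<Sum>y\<in>set cs. qscale (u x y) y) (\<Sum>y\<in>set cs. qscale (u z y) y)"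
      by (intro arg_cong2[of _ _ _ _ "lat_form L"] u)
    then show "lat_form L x z = (\<Sum>y'\<in>set cs. (\<Sum>y\<in>set cs. qbar (u x y) * lat_form L y y') * u z y')"
      by (simp add: form_sum)
  qed
  also have "\<dots> = ?U' * list_mat cs cs (lat_form L) * transpose_mat ?U"
    by (simp add: list_mat_transpose list_mat_mult[OF c(1)])
  finally have "det (gram_matrix L bs) = det ?U' * det (gram_matrix L cs) * det (transpose_mat ?U)"
    unfolding gram by (simp add: det_mult[of _ ?n] len carrier_matI)
  also have "det (transpose_mat ?U) = det ?U"
    by (rule det_transpose[of _ ?n]) (simp add: carrier_matI len)
  also have "det ?U' = qbar (det ?U)"
  proof -
    have "?U' = map_mat qbar ?U"
      by (rule eq_matI) auto
    then show ?thesis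
      by (simp add: comm_ring_hom.hom_det[OF comm_ring_hom_qbar])
  qed
  also have "qbar (det ?U) * det (gram_matrix L cs) * det ?U = qbar (det ?U) * det ?U * det (gram_matrix L cs)"
    by (simp only: mult_ac)
  also have "qbar (det ?U) * det ?U = 1"
    by (rule laurent_unit_qbar) (rule det_list_mat_inverse[OF b(1) c(1) len uw])
  finally show ?thesis
    by simp
qed

lemma lat_det_q_cut_lattice:
  assumes "finite T"
  shows "lat_det (q_cut_lattice G T) = det (list_mat (enum_list T) (enum_list T) (q_cut_entry G T))"
proof -
  let ?L = "q_cut_lattice G T" and ?bs = "map ell (enum_list T)"
  note T = enum_list[OF assms]
  have basis: "lat_basis ?L ?bs"
    by (rule lat_basis_ell) (simp_all add: T)
  have "lat_det ?L = det (gram_matrix ?L ?bs)"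
    unfolding lat_det_def
  proof (rule the_equality)
    show "\<exists>bs. lat_basis ?L bs \<and> det (gram_matrix ?L ?bs) = det (gram_matrix ?L bs)"
      using basis by blast
    fix d assume "\<exists>bs. lat_basis ?L bs \<and> d = det (gram_matrix ?L bs)"
    then obtain bs where bs: "lat_basis ?L bs" "d = det (gram_matrix ?L bs)"
      by blast
    show "d = det (gram_matrix ?L ?bs)"
      unfolding bs(2) by (rule det_gram_basis_change[OF bs(1) basis])
        (rule q_cut_lattice_form_sesquilinear)+
  qed
  also have "gram_matrix ?L ?bs = list_mat (enum_list T) (enum_list T) (q_cut_entry G T)"
    using nth_mem[of _ "enum_list T"]
    by (intro eq_matI) (auto simp: gram_matrix_def T intro!: q_cut_lattice_form_ell assms)
  finally show ?thesis .
qed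

section \<open>Potentials, connectedness and cycles\<close>

text \<open>
  Connectedness, cuts and the relations that cycles impose are all expressed through the differences
  of vertex potentials, which turns them into linear algebra.
\<close>

definition coboundary :: "('v, 'e) pre_digraph \<Rightarrow> ('v \<Rightarrow> int) \<Rightarrow> 'e \<Rightarrow> int" where
  "coboundary G g e = g (head G e) - g (tail G e)"

lemma spanning_subgraph_simps [simp]:
  "verts (spanning_subgraph G S) = verts G" "arcs (spanning_subgraph G S) = S"
  "tail (spanning_subgraph G S) = tail G" "head (spanning_subgraph G S) = head G"
  by (simp_all add: spanning_subgraph_def)

lemma coboundary_spanning_subgraph [simp]:
  "coboundary (spanning_subgraph G S) g = coboundary G g"
  by (simp add: coboundary_def fun_eq_iff)

lemma del_arc_spanning_subgraph:
  "pre_digraph.del_arc (spanning_subgraph G S) i = spanning_subgraph G (S - {i})"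
  by (simp add: pre_digraph.del_arc_def spanning_subgraph_def)

lemma (in wf_digraph) wf_spanning_subgraph:
  assumes "S \<subseteq> arcs G"
  shows "wf_digraph (spanning_subgraph G S)"
  using assms wellformed by unfold_locales auto

abbreviation linked :: "('v, 'e) pre_digraph \<Rightarrow> 'v \<Rightarrow> 'v \<Rightarrow> bool" where
  "linked G \<equiv> reachable (with_proj (mk_symmetric G))"

lemma arcs_ends_mk_symmetric:
  "arcs_ends (with_proj (mk_symmetric G)) = (\<Union>e\<in>arcs G. {(tail G e, head G e), (head G e, tail G e)})"
  by (simp add: arcs_ends_def arc_to_ends_def parcs_mk_symmetric)

context wf_digraph
begin

lemma linked_refl: "u \<in> verts G \<Longrightarrow> linked G u u"
  by (simp add: reachable_def)

lemma linked_trans: "linked G u v \<Longrightarrow> linked G v w \<Longrightarrow> linked G u w"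
  unfolding reachable_def by (rule rtrancl_on_trans)

lemma linked_sym: "linked G u v \<Longrightarrow> linked G v u"
  by (rule symmetric_reachable[OF symmetric_mk_symmetric])

lemma linked_arc: "e \<in> arcs G \<Longrightarrow> linked G (tail G e) (head G e)"
  unfolding reachable_def arcs_ends_mk_symmetric
  by (rule rtrancl_on_into_rtrancl_on[OF rtrancl_on_refl]) auto

lemma linked_arc_iff: "e \<in> arcs G \<Longrightarrow> linked G u (tail G e) \<longleftrightarrow> linked G u (head G e)"
  using linked_arc[of e] linked_sym[of "tail G e" "head G e"] linked_trans[of u] by blast

lemma linked_potential:
  assumes "linked G u v" and "\<And>e. e \<in> arcs G \<Longrightarrow> coboundary G g e = 0"
  shows "g u = g v"
  using assms(1) unfolding reachable_def arcs_ends_mk_symmetric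
  by (induction rule: rtrancl_on_induct) (use assms(2) in \<open>auto simp: coboundary_def\<close>)

text \<open>
  For the converse direction the indicator of the component of a vertex is a potential that is
  constant along edges.
\<close>

lemma connected_iff_potentials_constant:
  "Digraph_Component.connected G \<longleftrightarrow> verts G \<noteq> {} \<and>
    (\<forall>g. (\<forall>e\<in>arcs G. coboundary G g e = 0) \<longrightarrow> (\<forall>u\<in>verts G. \<forall>v\<in>verts G. g u = g v))"
  (is "_ \<longleftrightarrow> _ \<and> ?const")
proof
  assume "Digraph_Component.connected G"
  then have "verts G \<noteq> {}" and linked: "\<And>u v. u \<in> verts G \<Longrightarrow> v \<in> verts G \<Longrightarrow> linked G u v"
    by (simp_all add: connected_def strongly_connected_def with_proj_simps)
  moreover have ?const
  proof (intro allI impI ballI)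
    fix g u v
    assume "\<forall>e\<in>arcs G. coboundary G g e = 0" "u \<in> verts G" "v \<in> verts G"
    then show "g u = g v"
      using linked_potential[of u v g] linked by simp
  qed
  ultimately show "verts G \<noteq> {} \<and> ?const"
    by simp
next
  assume *: "verts G \<noteq> {} \<and> ?const"
  have "linked G u v" if "u \<in> verts G" "v \<in> verts G" for u v
  proof -
    let ?g = "\<lambda>w. if linked G u w then 1 else 0 :: int"
    have "\<forall>e\<in>arcs G. coboundary G ?g e = 0"
      by (simp add: coboundary_def linked_arc_iff)
    with * that have "?g u = ?g v"
      by blast
    then show ?thesis
      using linked_refl[OF that(1)] by (simp split: if_splits)
  qed
  with * show "Digraph_Component.connected G"
    by (simp add: connected_def strongly_connected_def)
qed

end

lemma bidirect_simps [simp]: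
  "verts (bidirect G) = verts G" "arcs (bidirect G) = arcs G \<times> UNIV"
  "tail (bidirect G) (e, b) = (if b then tail G e else head G e)"
  "head (bidirect G) (e, b) = (if b then head G e else tail G e)"
  by (simp_all add: bidirect_def)

lemma (in wf_digraph) wf_bidirect: "wf_digraph (bidirect G)"
  by unfold_locales auto

definition step_sign :: "'e \<times> bool \<Rightarrow> int" where
  "step_sign s = (if snd s then 1 else - 1)"

lemma walk_coboundary:
  assumes "pre_digraph.cas (bidirect G) u p v"
  shows "(\<Sum>s\<leftarrow>p. step_sign s * coboundary G g (fst s)) = g v - g u"
  using assms
proof (induction p arbitrary: u)
  case (Cons s p)
  obtain e b where s: "s = (e, b)"
    by (cases s)
  show ?case
    using Cons.IH[of "head (bidirect G) s"] Cons.prems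
    by (auto simp: s pre_digraph.cas.simps step_sign_def coboundary_def)
qed (simp add: pre_digraph.cas.simps)

text \<open>
  The flow sends one unit around the cycle, with the sign of the direction in which an edge is
  traversed.  As no edge is traversed twice, nothing cancels and the flow is nonzero; summing a
  coboundary against it telescopes around the cycle.
\<close>

lemma undirected_cycle_flow:
  assumes "undirected_cycle G p" "finite (arcs G)"
  obtains z :: "'e \<Rightarrow> int"
  where "\<exists>e\<in>arcs G. z e \<noteq> 0" "\<And>g. (\<Sum>e\<in>arcs G. coboundary G g e * z e) = 0"
proof -
  from assms(1) obtain u where cas: "pre_digraph.cas (bidirect G) u p u"
    and arcs: "set p \<subseteq> arcs G \<times> UNIV" and "p \<noteq> []" and dist: "distinct (map fst p)"
    by (auto simp: undirected_cycle_def pre_digraph.cycle_def pre_digraph.awalk_def)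
  define z where "z e = (case map_of p e of None \<Rightarrow> 0 | Some b \<Rightarrow> step_sign (e, b))" for e
  have z: "z (fst s) = step_sign s" if "s \<in> set p" for s
  proof -
    have "map_of p (fst s) = Some (snd s)"
      using that dist by (simp add: map_of_eq_Some_iff)
    then show ?thesis
      by (simp add: z_def)
  qed
  have z_outside: "z e = 0" if "e \<notin> fst ` set p" for e
    using that by (simp add: z_def map_of_eq_None_iff[THEN iffD2])
  have "(\<Sum>e\<in>arcs G. coboundary G g e * z e) = 0" for g
  proof -
    have "(\<Sum>e\<in>arcs G. coboundary G g e * z e) = (\<Sum>e\<in>set (map fst p). coboundary G g e * z e)"
      using arcs assms(2)
      by (intro sum.mono_neutral_right) (auto simp: z_outside)
    also have "\<dots> = (\<Sum>e\<leftarrow>map fst p. coboundary G g e * z e)"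
      by (rule sum.distinct_set_conv_list[OF dist])
    also have "\<dots> = (\<Sum>s\<leftarrow>p. step_sign s * coboundary G g (fst s))"
      unfolding map_map by (rule arg_cong[of _ _ sum_list], rule map_cong) (simp_all add: z)
    also have "\<dots> = 0"
      by (simp add: walk_coboundary[OF cas])
    finally show ?thesis .
  qed
  moreover have "\<exists>e\<in>arcs G. z e \<noteq> 0"
  proof (rule bexI)
    show "z (fst (hd p)) \<noteq> 0"
      using \<open>p \<noteq> []\<close> by (simp add: z step_sign_def)
    show "fst (hd p) \<in> arcs G"
      using \<open>p \<noteq> []\<close> arcs by (metis hd_in_set mem_Times_iff subsetD)
  qed
  ultimately show ?thesis
    using that by blast
qed

text \<open>
  Traversing an edge a second time, in whichever direction, revisits the start vertex of the first
  traversal.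
\<close>

lemma (in wf_digraph) apath_bidirect_distinct_edges:
  assumes "pre_digraph.apath (bidirect G) u p v"
  shows "distinct (map fst p)"
proof -
  interpret B: wf_digraph "bidirect G"
    by (rule wf_bidirect)
  show ?thesis
    using assms
  proof (induction p arbitrary: u)
    case (Cons s p)
    obtain e b where s: "s = (e, b)"
      by (cases s)
    have path: "B.apath (head (bidirect G) s) p v"
      and u: "tail (bidirect G) s \<notin> set (B.awalk_verts (head (bidirect G) s) p)"
      using Cons.prems by (auto simp: B.apath_Cons_iff)
    have "(e, b') \<notin> set p" for b'
    proof
      assume "(e, b') \<in> set p"
      then have "tail (bidirect G) (e, b') \<in> set (B.awalk_verts (head (bidirect G) s) p)"
        "head (bidirect G) (e, b') \<in> set (B.awalk_verts (head (bidirect G) s) p)"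
        using path[unfolded B.apath_def, THEN conjunct1, THEN B.set_awalk_verts]
        by (simp_all del: bidirect_simps)
      then show False
        using u by (auto simp: s split: if_splits)
    qed
    then show ?case
      using Cons.IH[OF path] by (auto simp: s)
  qed simp
qed

lemma (in wf_digraph) linked_imp_bidirect_apath:
  assumes "linked G u v"
  obtains p where "pre_digraph.apath (bidirect G) u p v"
proof -
  interpret B: wf_digraph "bidirect G"
    by (rule wf_bidirect)
  have "arcs_ends (with_proj (mk_symmetric G)) \<subseteq> arcs_ends (bidirect G)"
  proof
    fix x assume "x \<in> arcs_ends (with_proj (mk_symmetric G))"
    then obtain e where e: "e \<in> arcs G" "x = (tail G e, head G e) \<or> x = (head G e, tail G e)"
      by (auto simp: parcs_mk_symmetric)
    then have "(e, True) \<in> arcs (bidirect G)" "(e, False) \<in> arcs (bidirect G)"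
      by simp_all
    then have "arc_to_ends (bidirect G) (e, True) \<in> arcs_ends (bidirect G)"
      "arc_to_ends (bidirect G) (e, False) \<in> arcs_ends (bidirect G)"
      by (simp_all only: arcs_ends_def imageI)
    then show "x \<in> arcs_ends (bidirect G)"
      using e by (auto simp: arc_to_ends_def)
  qed
  then have "reachable (bidirect G) u v"
    using assms rtrancl_on_mono[of _ _ "verts G" "verts G"] by (simp add: reachable_def)
  then show ?thesis
    using that B.reachable_apath by blast
qed

text \<open>
  A path that connects the ends of \<open>i\<close> and avoids \<open>i\<close> closes up along \<open>i\<close>.
\<close>

lemma (in wf_digraph) cycle_through_linked_arc:
  assumes i: "i \<in> arcs G" and H: "linked (spanning_subgraph G (arcs G - {i})) (tail G i) (head G i)"
  shows "\<exists>p. undirected_cycle G p"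
proof -
  let ?H = "spanning_subgraph G (arcs G - {i})"
  interpret H: wf_digraph ?H
    by (rule wf_spanning_subgraph) auto
  interpret BH: wf_digraph "bidirect ?H"
    by (rule H.wf_bidirect)
  interpret B: wf_digraph "bidirect G"
    by (rule wf_bidirect)
  obtain p where p: "BH.apath (tail G i) p (head G i)"
    by (rule H.linked_imp_bidirect_apath[OF H])
  have "tail (bidirect ?H) = tail (bidirect G)" "head (bidirect ?H) = head (bidirect G)"
    by (simp_all add: fun_eq_iff)
  then have verts: "BH.awalk_verts u q = B.awalk_verts u q" and cas: "BH.cas u q v = B.cas u q v" for u q v
    by (induction q arbitrary: u) simp_all
  let ?c = "(i, False) # p"
  have "B.awalk (head G i) ?c (head G i)"
    using p i by (auto simp: BH.apath_def BH.awalk_def B.awalk_def cas B.cas.simps wellformed)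
  moreover have "distinct (tl (B.awalk_verts (head G i) ?c))"
    using p by (simp add: BH.apath_def verts)
  moreover have "distinct (map fst ?c)"
    using p H.apath_bidirect_distinct_edges[OF p] by (auto simp: BH.apath_def BH.awalk_def)
  ultimately have "undirected_cycle G ?c"
    unfolding undirected_cycle_def B.cycle_def by (intro conjI exI[of _ "head G i"]) simp_all
  then show ?thesis ..
qed

section \<open>Spanning trees and fundamental cuts\<close>

context wf_digraph
begin

lemma spanning_tree_potential:
  assumes T: "spanning_tree_edges G T" and g: "\<And>i. i \<in> T \<Longrightarrow> coboundary G g i = 0"
    and uv: "u \<in> verts G" "v \<in> verts G"
  shows "g u = g v"
proof -
  interpret T: wf_digraph "spanning_subgraph G T"
    using T by (intro wf_spanning_subgraph) (simp add: spanning_tree_edges_def)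
  have "Digraph_Component.connected (spanning_subgraph G T)"
    using T by (simp add: spanning_tree_edges_def undirected_tree_def)
  then show ?thesis
    unfolding T.connected_iff_potentials_constant using g uv by simp
qed

text \<open>
  A potential for the fundamental cut: the indicator of the side of \<open>T - {i}\<close> towards which \<open>i\<close>
  is directed.
\<close>

definition far_side :: "'b set \<Rightarrow> 'b \<Rightarrow> 'a \<Rightarrow> int" where
  "far_side T i v = (if v \<in> component_of (spanning_subgraph G (T - {i})) (head G i) then 1 else 0)"

text \<open>
  The two components of \<open>T - {i}\<close> are disjoint since \<open>T\<close> has no cycle, and cover all vertices since
  \<open>T\<close> is connected.  So every edge either stays on one side or crosses the cut, and its entry in the
  cut is the difference of the indicator.
\<close>

lemma fundamental_cut_coboundary:
  assumes T: "spanning_tree_edges G T" and i: "i \<in> T" and e: "e \<in> arcs G"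
  shows "fundamental_cut G T i e = coboundary G (far_side T i) e"
proof -
  let ?H = "spanning_subgraph G (T - {i})"
  have sub: "T \<subseteq> arcs G"
    using T by (simp add: spanning_tree_edges_def)
  interpret T: wf_digraph "spanning_subgraph G T"
    by (rule wf_spanning_subgraph[OF sub])
  interpret H: wf_digraph ?H
    using sub by (intro wf_spanning_subgraph) auto
  let ?V0 = "component_of ?H (tail G i)" and ?V1 = "component_of ?H (head G i)"
  have disjoint: "\<not> (v \<in> ?V0 \<and> v \<in> ?V1)" for v
  proof
    assume "v \<in> ?V0 \<and> v \<in> ?V1"
    then have "linked ?H (tail G i) (head G i)"
      using H.linked_sym[of "head G i" v] H.linked_trans[of "tail G i" v "head G i"]
      by (simp add: component_of_def)
    then have "\<exists>p. undirected_cycle (spanning_subgraph G T) p"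
      using T.cycle_through_linked_arc[of i] i by (simp add: spanning_subgraph_def)
    then show False
      using T by (simp add: spanning_tree_edges_def undirected_tree_def)
  qed
  have ends: "tail G i \<in> ?V0" "head G i \<in> ?V1"
    using i sub by (auto simp: component_of_def intro!: H.linked_refl)
  have cover: "v \<in> ?V0 \<union> ?V1" if "v \<in> verts G" for v
  proof -
    \<comment> \<open>Edges of \<open>T\<close> never leave this union: \<open>i\<close> lies inside it, the others stay within one component.\<close>
    let ?g = "\<lambda>v. if v \<in> ?V0 \<union> ?V1 then 1 else 0 :: int"
    have "coboundary G ?g j = 0" if "j \<in> T" for j
    proof (cases "j = i")
      case False
      then show ?thesis
        using H.linked_arc_iff[of j] that by (simp add: coboundary_def component_of_def)
    qed (simp add: coboundary_def ends)
    then have "?g v = ?g (tail G i)"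
      by (rule spanning_tree_potential[OF T _ that]) (use i sub in auto)
    then show ?thesis
      using ends by (simp split: if_splits)
  qed
  show ?thesis
    using cover[of "tail G e"] cover[of "head G e"] disjoint[of "tail G e"] disjoint[of "head G e"] e
    by (auto simp: fundamental_cut_def Let_def del_arc_spanning_subgraph coboundary_def far_side_def)
qed

lemma fundamental_cut_tree_edge:
  assumes T: "spanning_tree_edges G T" and i: "i \<in> T" and j: "j \<in> T"
  shows "fundamental_cut G T i j = (if i = j then 1 else 0)"
proof -
  let ?H = "spanning_subgraph G (T - {i})"
  have sub: "T \<subseteq> arcs G"
    using T by (simp add: spanning_tree_edges_def)
  interpret H: wf_digraph ?H
    using sub by (intro wf_spanning_subgraph) auto
  show ?thesis
  proof (cases "i = j")
    case True
    have "linked ?H (tail G i) (tail G i)" "linked ?H (head G i) (head G i)"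
      by (rule H.linked_refl, use sub i in auto)+
    then show ?thesis
      using sub i True
      by (auto simp: fundamental_cut_def Let_def del_arc_spanning_subgraph component_of_def)
  next
    case False
    then show ?thesis
      using H.linked_arc_iff[of j] j sub
      by (auto simp: fundamental_cut_coboundary[OF T i] coboundary_def far_side_def component_of_def)
  qed
qed

text \<open>
  Both sides are coboundaries, and by \<open>fundamental_cut_tree_edge\<close> they agree on \<open>T\<close>.
  A coboundary vanishing on a spanning tree vanishes everywhere, because its potential is constant.  Thus the fundamental cuts
  form a basis of the cut lattice, in which coordinates are read off on \<open>T\<close>.
\<close>

lemma coboundary_expansion:
  assumes T: "spanning_tree_edges G T" and "finite T" and e: "e \<in> arcs G"
  shows "coboundary G g e = (\<Sum>i\<in>T. coboundary G g i * fundamental_cut G T i e)"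
proof -
  \<comment> \<open>The difference of the two sides is the coboundary of this potential.\<close>
  let ?h = "\<lambda>v. g v - (\<Sum>i\<in>T. coboundary G g i * far_side T i v)"
  have h: "coboundary G ?h e = coboundary G g e - (\<Sum>i\<in>T. coboundary G g i * fundamental_cut G T i e)"
    if "e \<in> arcs G" for e
    using that
    by (simp add: coboundary_def[of G ?h] coboundary_def[of G g e] fundamental_cut_coboundary[OF T]
        coboundary_def[of G "far_side T _"] right_diff_distrib sum_subtractf)
  have "?h (tail G e) = ?h (head G e)"
  proof (rule spanning_tree_potential[OF T])
    fix j assume j: "j \<in> T"
    then have "j \<in> arcs G"
      using T by (auto simp: spanning_tree_edges_def)
    moreover have "(\<Sum>i\<in>T. coboundary G g i * fundamental_cut G T i j) = (\<Sum>i\<in>T. if i = j then coboundary G g j else 0)"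
      using j by (intro sum.cong) (auto simp: fundamental_cut_tree_edge[OF T])
    ultimately show "coboundary G ?h j = 0"
      using j \<open>finite T\<close> by (simp add: h sum.delta)
  qed (use e in auto)
  then show ?thesis
    using h[OF e] by (simp add: coboundary_def[of G ?h])
qed

text \<open>
  Each fundamental cut of \<open>T\<close> is expanded in the fundamental cuts of \<open>S\<close> and read off on \<open>T\<close>.
  Hence the matrices that restrict the cuts of one tree to the other tree are mutually inverse
  over \<open>\<int>\<close>.
\<close>

lemma exchange_inverse:
  assumes T: "spanning_tree_edges G T" and S: "spanning_tree_edges G S" "finite S"
    and i: "i \<in> T" and l: "l \<in> T"
  shows "(\<Sum>j\<in>S. fundamental_cut G T i j * fundamental_cut G S j l) = (if i = l then 1 else 0)"
proof -
  have sub: "T \<subseteq> arcs G" "S \<subseteq> arcs G"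
    using T S by (auto simp: spanning_tree_edges_def)
  have "(\<Sum>j\<in>S. fundamental_cut G T i j * fundamental_cut G S j l) =
    (\<Sum>j\<in>S. coboundary G (far_side T i) j * fundamental_cut G S j l)"
    using sub by (intro sum.cong) (auto simp: fundamental_cut_coboundary[OF T i])
  also have "\<dots> = fundamental_cut G T i l"
    using sub l coboundary_expansion[OF S, of l] by (auto simp: fundamental_cut_coboundary[OF T i])
  finally show ?thesis
    by (simp add: fundamental_cut_tree_edge[OF T i l])
qed

end

section \<open>Minors of the matrix of fundamental cuts\<close>

context fin_digraph
begin

lemma finite_spanning_tree: "spanning_tree_edges G T \<Longrightarrow> finite T"
  unfolding spanning_tree_edges_def using finite_arcs finite_subset by blast

text \<open>
  The restriction matrices of \<open>exchange_inverse\<close> are inverse to each other on both sides, so they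
  are square.
\<close>

lemma card_spanning_tree_unique:
  assumes "spanning_tree_edges G T" "spanning_tree_edges G S"
  shows "card T = card S"
  by (rule inverse_matrices_square[where a = "fundamental_cut G T" and b = "fundamental_cut G S"])
    (simp_all add: assms finite_spanning_tree exchange_inverse)

text \<open>
  If \<open>S\<close> is a spanning tree, the minor is invertible over \<open>\<int>\<close>, hence \<open>\<plusminus>1\<close>.  Otherwise \<open>S\<close> is
  disconnected or contains a cycle.  In the first case a nonconstant potential that is constant
  along \<open>S\<close> gives, through its differences on \<open>T\<close>, a nontrivial relation between the rows.  In the
  second case the flow around the cycle gives a nontrivial relation between the columns.
\<close>

lemma det_fundamental_cuts_squared:
  assumes T: "spanning_tree_edges G T" and S: "S \<subseteq> arcs G" "card S = card T"
  shows "det (list_mat (enum_list T) (enum_list S) (fundamental_cut G T)) ^ 2 =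
    (if spanning_tree_edges G S then 1 else 0)"
proof -
  let ?K = "list_mat (enum_list T) (enum_list S) (fundamental_cut G T)"
  have sub: "T \<subseteq> arcs G"
    using T by (simp add: spanning_tree_edges_def)
  have finT: "finite T" and finS: "finite S"
    using sub S(1) finite_subset[OF _ finite_arcs] by blast+
  note T' = enum_list[OF finT] and S' = enum_list[OF finS]
  interpret S: wf_digraph "spanning_subgraph G S"
    by (rule wf_spanning_subgraph[OF S(1)])
  consider (tree) "spanning_tree_edges G S"
    | (disconnected) "\<not> Digraph_Component.connected (spanning_subgraph G S)" "\<not> spanning_tree_edges G S"
    | (cyclic) p where "undirected_cycle (spanning_subgraph G S) p" "\<not> spanning_tree_edges G S"
    using S(1) unfolding spanning_tree_edges_def undirected_tree_def by blast
  then show ?thesis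
  proof cases
    case tree
    have "det ?K * det (list_mat (enum_list S) (enum_list T) (fundamental_cut G S)) = 1"
      by (rule det_list_mat_inverse) (simp_all add: T' S' S(2) exchange_inverse T tree finS)
    then have "det ?K = 1 \<or> det ?K = - 1"
      using zmult_eq_1_iff by blast
    then show ?thesis
      using tree by auto
  next
    case disconnected
    have "verts G \<noteq> {}"
      using T by (simp add: spanning_tree_edges_def undirected_tree_def connected_def strongly_connected_def)
    then obtain g u v where g: "\<forall>e\<in>S. coboundary G g e = 0" and uv: "u \<in> verts G" "v \<in> verts G" "g u \<noteq> g v"
      using disconnected(1) unfolding S.connected_iff_potentials_constant by auto
    then obtain i where i: "i \<in> T" "coboundary G g i \<noteq> 0"
      using spanning_tree_potential[OF T, of g u v] by blast
    have "det ?K = 0"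
    proof (rule det_list_mat_left_kernel[where x = i and z = "coboundary G g"])
      fix e assume "e \<in> set (enum_list S)"
      then have e: "e \<in> S" "e \<in> arcs G"
        using S(1) by (auto simp: S')
      show "(\<Sum>i\<in>set (enum_list T). coboundary G g i * fundamental_cut G T i e) = 0"
        using coboundary_expansion[OF T finT e(2), of g] g e(1) by (simp add: T')
    qed (simp_all add: T' S' S(2) i)
    then show ?thesis
      using disconnected(2) by simp
  next
    case cyclic
    obtain z where z: "\<exists>e\<in>S. z e \<noteq> 0" "\<And>g. (\<Sum>e\<in>S. coboundary G g e * z e) = 0"
      using undirected_cycle_flow[OF cyclic(1)] finS by auto
    then obtain e where e: "e \<in> S" "z e \<noteq> 0"
      by blast
    have "det ?K = 0"
    proof (rule det_list_mat_right_kernel[where y = e and z = z])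
      fix i assume "i \<in> set (enum_list T)"
      then have i: "i \<in> T"
        by (simp add: T')
      have "(\<Sum>e\<in>S. fundamental_cut G T i e * z e) = (\<Sum>e\<in>S. coboundary G (far_side T i) e * z e)"
        using S(1) by (intro sum.cong) (auto simp: fundamental_cut_coboundary[OF T i])
      then show "(\<Sum>e\<in>set (enum_list S). fundamental_cut G T i e * z e) = 0"
        by (simp add: S' z(2))
    qed (simp_all add: T' S' S(2) e)
    then show ?thesis
      using cyclic(2) by simp
  qed
qed

text \<open>
  Restricted to the edges of \<open>T\<close>, the fundamental cuts are orthonormal.  The form of the
  \<open>q\<close>-cut lattice leaves this part of the Euclidean product untouched and multiplies the part coming
  from the edges outside \<open>T\<close> by \<open>q\<^sup>2\<close>.
\<close>

lemma q_cut_entry_weighted_sum: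
  assumes T: "spanning_tree_edges G T" and i: "i \<in> T" and j: "j \<in> T"
  shows "q_cut_entry G T i j = (\<Sum>e\<in>arcs G. of_int (fundamental_cut G T i e) *
    ((if e \<in> T then 1 else qvar ^ 2) * of_int (fundamental_cut G T j e)))"
proof -
  let ?K = "fundamental_cut G T"
  let ?P = "\<Sum>e\<in>arcs G - T. ?K i e * ?K j e"
  have sub: "T \<subseteq> arcs G"
    using T by (simp add: spanning_tree_edges_def)
  have tree_part: "(\<Sum>e\<in>T. ?K i e * ?K j e) = (if i = j then 1 else 0)"
  proof -
    have "(\<Sum>e\<in>T. ?K i e * ?K j e) = (\<Sum>e\<in>T. if i = e then (if i = j then 1 else 0) else 0)"
      by (intro sum.cong) (auto simp: fundamental_cut_tree_edge[OF T] i j)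
    then show ?thesis
      using i finite_spanning_tree[OF T] by (simp add: sum.delta')
  qed
  have inner: "edge_inner G (?K i) (?K j) = ?P + (if i = j then 1 else 0)"
    unfolding edge_inner_def sum.subset_diff[OF sub finite_arcs] tree_part ..
  have "(\<Sum>e\<in>arcs G. of_int (?K i e) * ((if e \<in> T then 1 else qvar ^ 2) * of_int (?K j e))) =
    (\<Sum>e\<in>arcs G - T. of_int (?K i e) * (qvar ^ 2 * of_int (?K j e))) + (\<Sum>e\<in>T. of_int (?K i e) * of_int (?K j e))"
    unfolding sum.subset_diff[OF sub finite_arcs] by simp
  also have "\<dots> = of_int ?P * qvar ^ 2 + of_int (\<Sum>e\<in>T. ?K i e * ?K j e)"
    by (simp add: sum_distrib_left sum_distrib_right mult_ac)
  finally show ?thesis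
    unfolding tree_part by (cases "i = j") (use inner in \<open>simp_all add: q_cut_entry_def Let_def\<close>)
qed

text \<open>
  The Gram matrix is \<open>K D K\<^sup>T\<close> with \<open>D\<close> the diagonal matrix of edge weights, so Cauchy--Binet
  writes its determinant as the sum of squared minors of \<open>K\<close>, each weighted by the product of the
  edge weights, which is \<open>q\<^sup>2\<close> for every edge that \<open>S\<close> does not share with \<open>T\<close>.
\<close>

theorem lat_det_q_cut_lattice_eq_sum_trees:
  assumes T: "spanning_tree_edges G T"
  shows "lat_det (q_cut_lattice G T) = (\<Sum>S | spanning_tree_edges G S. qvar ^ (2 * card (S - T)))"
proof -
  let ?K = "fundamental_cut G T" and ?w = "\<lambda>e. if e \<in> T then 1 else qvar ^ 2"
  let ?r = "card T"
  have finT: "finite T"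
    using T by (rule finite_spanning_tree)
  note T' = enum_list[OF finT]
  have "lat_det (q_cut_lattice G T) = det (list_mat (enum_list T) (enum_list T)
    (\<lambda>i j. \<Sum>e\<in>arcs G. of_int (?K i e) * (?w e * of_int (?K j e))))"
    unfolding lat_det_q_cut_lattice[OF finT]
    by (intro arg_cong[of _ _ det] list_mat_cong) (simp only: T' q_cut_entry_weighted_sum[OF T])
  also have "\<dots> = (\<Sum>S | S \<subseteq> arcs G \<and> card S = ?r.
      det (list_mat (enum_list T) (enum_list S) (\<lambda>i e. of_int (?K i e))) *
      det (list_mat (enum_list S) (enum_list T) (\<lambda>e j. ?w e * of_int (?K j e))))"
    by (rule Cauchy_Binet) (simp_all add: T')
  also have "\<dots> = (\<Sum>S | S \<subseteq> arcs G \<and> card S = ?r.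
      if spanning_tree_edges G S then qvar ^ (2 * card (S - T)) else 0)"
  proof (intro sum.cong refl)
    fix S assume "S \<in> {S. S \<subseteq> arcs G \<and> card S = ?r}"
    then have S: "S \<subseteq> arcs G" "card S = ?r"
      by simp_all
    then have finS: "finite S"
      using finite_subset[OF _ finite_arcs] by blast
    note S' = enum_list[OF finS]
    let ?M = "list_mat (enum_list T) (enum_list S) ?K"
    have "list_mat (enum_list T) (enum_list S) (\<lambda>i e. of_int (?K i e) :: laurent) = map_mat of_int ?M"
      by (rule eq_matI) auto
    then have det1: "det (list_mat (enum_list T) (enum_list S) (\<lambda>i e. of_int (?K i e))) = (of_int (det ?M) :: laurent)"
      by (simp add: of_int_hom.hom_det)
    have "list_mat (enum_list S) (enum_list T) (\<lambda>e j. of_int (?K j e) :: laurent) =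
      map_mat of_int (transpose_mat ?M)"
      by (rule eq_matI) auto
    then have det2: "det (list_mat (enum_list S) (enum_list T) (\<lambda>e j. of_int (?K j e))) = (of_int (det ?M) :: laurent)"
      using det_transpose[of ?M ?r] by (simp add: of_int_hom.hom_det carrier_matI T' S' S(2))
    have "(\<Prod>e\<in>S. ?w e) = (\<Prod>e\<in>S - T. qvar ^ 2)"
      using finS by (intro prod.mono_neutral_cong_right) auto
    then have weight: "(\<Prod>e\<in>S. ?w e) = qvar ^ (2 * card (S - T))"
      by (simp add: power_mult)
    have "det (list_mat (enum_list T) (enum_list S) (\<lambda>i e. of_int (?K i e))) *
      det (list_mat (enum_list S) (enum_list T) (\<lambda>e j. ?w e * of_int (?K j e))) =
      (\<Prod>e\<in>S. ?w e) * of_int (det ?M ^ 2)"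
      by (subst det_list_mat_scale_rows)
        (simp_all add: S' T' S(2) det1 det2 power2_eq_square mult_ac)
    also have "\<dots> = (if spanning_tree_edges G S then qvar ^ (2 * card (S - T)) else 0)"
      by (simp add: weight det_fundamental_cuts_squared[OF T S])
    finally show "det (list_mat (enum_list T) (enum_list S) (\<lambda>i e. of_int (?K i e))) *
      det (list_mat (enum_list S) (enum_list T) (\<lambda>e j. ?w e * of_int (?K j e))) =
      (if spanning_tree_edges G S then qvar ^ (2 * card (S - T)) else 0)" .
  qed
  also have "\<dots> = (\<Sum>S | spanning_tree_edges G S. qvar ^ (2 * card (S - T)))"
  proof (rule sum.mono_neutral_cong_right)
    show "{S. spanning_tree_edges G S} \<subseteq> {S. S \<subseteq> arcs G \<and> card S = ?r}"
      using card_spanning_tree_unique[OF T] by (auto simp: spanning_tree_edges_def)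
  qed auto
  finally show ?thesis .
qed

end

section \<open>Counting trees by their overlap\<close>

theorem theorem4p6:
  fixes \<Gamma> :: "('v, 'e) pre_digraph" and T :: "'e set" and r :: nat and c :: "nat \<Rightarrow> nat"
  assumes "fin_digraph \<Gamma>"
    and "two_edge_connected \<Gamma>"
    and "spanning_tree_edges \<Gamma> T"
    and "r = card T"
    and "\<And>i. i \<le> r \<Longrightarrow> c i = card {T'. spanning_tree_edges \<Gamma> T' \<and> card (T' \<inter> T) = r - i}"
  shows "lat_det (q_cut_lattice \<Gamma> T) = (\<Sum>i = 0..r. of_nat (c i) * qvar ^ (2 * i))
         \<and> c 0 = 1"
proof -
  interpret fin_digraph \<Gamma>
    by fact
  note T = assms(3)
  let ?trees = "{S. spanning_tree_edges \<Gamma> S}"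
  have "?trees \<subseteq> Pow (arcs \<Gamma>)"
    by (auto simp: spanning_tree_edges_def)
  then have fin: "finite ?trees"
    using finite_arcs finite_subset by blast
  have split: "card (S \<inter> T) + card (S - T) = r" if "spanning_tree_edges \<Gamma> S" for S
    using card_Int_Diff[OF finite_spanning_tree[OF that], of T] card_spanning_tree_unique[OF T that]
      assms(4) by simp
  have "lat_det (q_cut_lattice \<Gamma> T) = (\<Sum>S\<in>?trees. qvar ^ (2 * card (S - T)))"
    by (rule lat_det_q_cut_lattice_eq_sum_trees[OF T])
  also have "\<dots> = (\<Sum>i\<in>{0..r}. \<Sum>S | S \<in> ?trees \<and> card (S - T) = i. qvar ^ (2 * card (S - T)))"
    using split by (intro sum.group[symmetric] fin) force+
  also have "\<dots> = (\<Sum>i = 0..r. of_nat (c i) * qvar ^ (2 * i))"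
  proof (intro sum.cong refl)
    fix i assume "i \<in> {0..r}"
    then have "i \<le> r"
      by simp
    have "{S. S \<in> ?trees \<and> card (S - T) = i} = {S. spanning_tree_edges \<Gamma> S \<and> card (S \<inter> T) = r - i}"
    proof (intro Collect_cong)
      fix S
      show "S \<in> ?trees \<and> card (S - T) = i \<longleftrightarrow> spanning_tree_edges \<Gamma> S \<and> card (S \<inter> T) = r - i"
        using split[of S] \<open>i \<le> r\<close> by auto
    qed
    then have "card {S. S \<in> ?trees \<and> card (S - T) = i} = c i"
      using assms(5)[OF \<open>i \<le> r\<close>] by simp
    then show "(\<Sum>S | S \<in> ?trees \<and> card (S - T) = i. qvar ^ (2 * card (S - T))) = of_nat (c i) * qvar ^ (2 * i)"
      by simp
  qed
  finally have "lat_det (q_cut_lattice \<Gamma> T) = (\<Sum>i = 0..r. of_nat (c i) * qvar ^ (2 * i))" .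
  moreover have "{S. spanning_tree_edges \<Gamma> S \<and> card (S \<inter> T) = r - 0} = {T}"
  proof (intro equalityI subsetI)
    fix S assume "S \<in> {S. spanning_tree_edges \<Gamma> S \<and> card (S \<inter> T) = r - 0}"
    then have S: "spanning_tree_edges \<Gamma> S" "card (S \<inter> T) = r"
      by auto
    then have "S \<subseteq> T"
      using split[OF S(1)] finite_spanning_tree[OF S(1)] by simp
    then show "S \<in> {T}"
      using card_subset_eq[OF finite_spanning_tree[OF T]] card_spanning_tree_unique[OF T S(1)] by simp
  qed (use T assms(4) in simp)
  ultimately show ?thesis
    using assms(5)[of 0] by simp
qed

end
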